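(* Let $a>0$, $i_1,i_3>0$, $\mu_r>0$, $C\in\mathbb R$, and consider the system for $(\boldsymbol\omega,\boldsymbol\gamma)\in\mathbb R^3\times\mathbb R^3$ $$\mathbf J\dot{\boldsymbol\omega}+\boldsymbol\omega\times\mathbf I\boldsymbol\omega+\big((\boldsymbol\omega,\tfrac{d}{dt}(\boldsymbol r\times\boldsymbol\gamma))-1\big)\,\boldsymbol r\times\boldsymbol\gamma=-\mu_r\,\boldsymbol\gamma\times(\boldsymbol\omega\times\boldsymbol\gamma),\qquad \dot{\boldsymbol\gamma}+\boldsymbol\omega\times\boldsymbol\gamma=0 .$$ Let $\sigma_u$ be its fixed point $\boldsymbol\gamma=(0,0,1)$, $\boldsymbol\omega=(0,0,C/i_3)$ (upper vertical rotation). If $i_3\le i_1$, then $\sigma_u$ is linearly unstable for every $C$. If $i_3>i_1$, then $\sigma_u$ is linearly stable if and only if $|C|>C^*$, where $C^*=\dfrac{i_3\sqrt a}{\sqrt{|i_1-i_3|}}$.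
   Context: The system describes, in dimensionless variables (mass, radius and gravitational acceleration equal to $1$), the rolling with slipping of an axisymmetric unbalanced ball on a plane when the only dissipative action is the horizontal rolling resistance torque $-\mu_r\boldsymbol\omega_\bot$, $\boldsymbol\omega_\bot=\boldsymbol\omega-(\boldsymbol\omega,\boldsymbol\gamma)\boldsymbol\gamma$. Notation: $\mathbf I=\mathrm{diag}(i_1,i_1,i_3)$, $\boldsymbol a=(0,0,a)$, $\boldsymbol r=-\boldsymbol\gamma-\boldsymbol a$, $\mathbf J=\mathbf I+(\boldsymbol r\times\boldsymbol\gamma)\otimes(\boldsymbol r\times\boldsymbol\gamma)$ with $(\boldsymbol x\otimes\boldsymbol y)_{ij}=x_iy_j$; thus $\boldsymbol r\times\boldsymbol\gamma=(a\gamma_2,-a\gamma_1,0)$ and $\frac{d}{dt}(\boldsymbol r\times\boldsymbol\gamma)=-\boldsymbol a\times(\boldsymbol\gamma\times\boldsymbol\omega)$. $C$ is the value of the area integral $(\mathbf J\boldsymbol\omega,\boldsymbol\gamma)$. The characteristic polynomial of the linearization of the six-dimensional system at such a fixed point has the form $\lambda^2P_4(\lambda)$, the two zero eigenvalues corresponding to the integrals $(\boldsymbol\gamma,\boldsymbol\gamma)$ and $(\mathbf J\boldsymbol\omega,\boldsymbol\gamma)$; the fixed point is called linearly stable if all four roots of $P_4$ have negative real parts, and linearly unstable if at least one root of $P_4$ has positive real part. *)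

theory Defs
  imports "HOL-Analysis.Analysis" "Jordan_Normal_Form.Char_Poly"
begin

unbundle cross3_syntax
no_notation Matrix.vec_index (infixl \<open>$\<close> 100)

definition inertia :: "real \<Rightarrow> real \<Rightarrow> real^3^3" where
  "inertia i1 i3 = (\<chi> j k. if j = k then (if j = 3 then i3 else i1) else 0)"

definition outer :: "real^3 \<Rightarrow> real^3 \<Rightarrow> real^3^3" where
  "outer x y = (\<chi> j k. x $ j * y $ k)"

definition offset :: "real \<Rightarrow> real^3" where
  "offset a = vector [0, 0, a]"

definition contact :: "real \<Rightarrow> real^3 \<Rightarrow> real^3" where
  "contact a \<gamma> = - \<gamma> - offset a"

definition rxg :: "real \<Rightarrow> real^3 \<Rightarrow> real^3" where
  "rxg a \<gamma> = contact a \<gamma> \<times> \<gamma>"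

text \<open>The time derivative of \<open>r \<times> \<gamma>\<close> along \<open>\<gamma>' = \<gamma> \<times> \<omega>\<close>, as a function of the state.\<close>

definition rxg_dot :: "real \<Rightarrow> real^3 \<Rightarrow> real^3 \<Rightarrow> real^3" where
  "rxg_dot a \<omega> \<gamma> = - (offset a \<times> (\<gamma> \<times> \<omega>))"

definition Jmat :: "real \<Rightarrow> real \<Rightarrow> real \<Rightarrow> real^3 \<Rightarrow> real^3^3" where
  "Jmat a i1 i3 \<gamma> = inertia i1 i3 + outer (rxg a \<gamma>) (rxg a \<gamma>)"

definition rolling_eqs ::
  "real \<Rightarrow> real \<Rightarrow> real \<Rightarrow> real \<Rightarrow> real^3 \<Rightarrow> real^3 \<Rightarrow> real^3 \<Rightarrow> real^3 \<Rightarrow> bool" where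
  "rolling_eqs a i1 i3 \<mu> \<omega> \<gamma> \<omega>' \<gamma>' \<longleftrightarrow>
     Jmat a i1 i3 \<gamma> *v \<omega>' + \<omega> \<times> (inertia i1 i3 *v \<omega>)
       + (\<omega> \<bullet> rxg_dot a \<omega> \<gamma> - 1) *\<^sub>R rxg a \<gamma>
       = - \<mu> *\<^sub>R (\<gamma> \<times> (\<omega> \<times> \<gamma>)) \<and>
     \<gamma>' + \<omega> \<times> \<gamma> = 0"

text \<open>The same system solved for the derivatives, as a vector field on \<open>\<real>\<^sup>3 \<times> \<real>\<^sup>3\<close>;
  \<open>rolling_eqs_iff_field\<close> below shows the equivalence.\<close>

definition rolling_field ::
  "real \<Rightarrow> real \<Rightarrow> real \<Rightarrow> real \<Rightarrow> (real^3) \<times> (real^3) \<Rightarrow> (real^3) \<times> (real^3)" where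
  "rolling_field a i1 i3 \<mu> = (\<lambda>(\<omega>, \<gamma>).
     (matrix_inv (Jmat a i1 i3 \<gamma>) *v
        (- \<mu> *\<^sub>R (\<gamma> \<times> (\<omega> \<times> \<gamma>)) - \<omega> \<times> (inertia i1 i3 *v \<omega>)
          - (\<omega> \<bullet> rxg_dot a \<omega> \<gamma> - 1) *\<^sub>R rxg a \<gamma>),
      - (\<omega> \<times> \<gamma>)))"

lemma invertible_Jmat:
  assumes "i1 > 0" "i3 > 0"
  shows "invertible (Jmat a i1 i3 \<gamma>)"
proof -
  have "x = 0" if "Jmat a i1 i3 \<gamma> *v x = 0" for x
  proof -
    define s where "s = rxg a \<gamma>"
    have "x \<bullet> (Jmat a i1 i3 \<gamma> *v x) =
        i1 * (x $ 1)\<^sup>2 + i1 * (x $ 2)\<^sup>2 + i3 * (x $ 3)\<^sup>2 + (s \<bullet> x)\<^sup>2"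
      by (simp add: Jmat_def s_def[symmetric] inertia_def outer_def inner_vec_def sum_3
          matrix_vector_mult_def power2_eq_square algebra_simps)
    then have "i1 * (x $ 1)\<^sup>2 + i1 * (x $ 2)\<^sup>2 + i3 * (x $ 3)\<^sup>2 + (s \<bullet> x)\<^sup>2 = 0"
      using that by simp
    moreover have "i1 * (x $ 1)\<^sup>2 \<ge> 0" "i1 * (x $ 2)\<^sup>2 \<ge> 0" "i3 * (x $ 3)\<^sup>2 \<ge> 0" "(s \<bullet> x)\<^sup>2 \<ge> 0"
      using assms by auto
    ultimately have "i1 * (x $ 1)\<^sup>2 = 0" "i1 * (x $ 2)\<^sup>2 = 0" "i3 * (x $ 3)\<^sup>2 = 0"
      by linarith+
    then show "x = 0"
      using assms by (simp add: Finite_Cartesian_Product.vec_eq_iff forall_3)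
  qed
  then show ?thesis
    by (simp add: invertible_left_inverse matrix_left_invertible_ker)
qed

lemma rolling_eqs_iff_field:
  assumes "i1 > 0" "i3 > 0"
  shows "rolling_eqs a i1 i3 \<mu> \<omega> \<gamma> \<omega>' \<gamma>' \<longleftrightarrow> (\<omega>', \<gamma>') = rolling_field a i1 i3 \<mu> (\<omega>, \<gamma>)"
proof -
  define J where "J = Jmat a i1 i3 \<gamma>"
  have "invertible J"
    unfolding J_def by (rule invertible_Jmat[OF assms])
  then have J: "J ** matrix_inv J = Finite_Cartesian_Product.mat 1" "matrix_inv J ** J = Finite_Cartesian_Product.mat 1"
    unfolding matrix_inv_def invertible_def by (metis (mono_tags, lifting) someI_ex)+
  have solve: "J *v w = b \<longleftrightarrow> w = matrix_inv J *v b" for w b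
    by (metis J matrix_vector_mul_assoc matrix_vector_mul_lid)
  have eq: "J *v \<omega>' + u + v = b \<longleftrightarrow> \<omega>' = matrix_inv J *v (b - u - v)" for u v b
    unfolding solve[symmetric] by (auto simp: algebra_simps)
  show ?thesis
    unfolding rolling_eqs_def rolling_field_def J_def[symmetric] case_prod_conv prod.inject eq
      eq_neg_iff_add_eq_0 by (rule refl)
qed

definition sigma_u :: "real \<Rightarrow> real \<Rightarrow> (real^3) \<times> (real^3)" where
  "sigma_u i3 C = (vector [0, 0, C / i3], vector [0, 0, 1])"

lemma sigma_u_fixed_point: "rolling_field a i1 i3 \<mu> (sigma_u i3 C) = 0"
proof -
  have 1: "rxg a (vector [0, 0, 1]) = 0"
    by (simp add: rxg_def contact_def offset_def cross3_def Finite_Cartesian_Product.vec_eq_iff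
        forall_3)
  have 2: "vector [0, 0, c] \<times> vector [0, 0, d] = (0 :: real^3)" for c d :: real
    by (simp add: cross3_def Finite_Cartesian_Product.vec_eq_iff forall_3)
  have 3: "inertia i1 i3 *v vector [0, 0, c] = (vector [0, 0, i3 * c] :: real^3)" for c
    by (simp add: inertia_def matrix_vector_mult_def sum_3 Finite_Cartesian_Product.vec_eq_iff
        forall_3)
  have 4: "u \<times> 0 = 0" for u
    by (rule cross_zero_right)
  show ?thesis
    unfolding rolling_field_def sigma_u_def case_prod_conv 1 2 3 4
    by (simp add: zero_prod_def)
qed

lemma sigma_u_area_integral:
  assumes "i3 \<noteq> 0"
  shows "(case sigma_u i3 C of (\<omega>, \<gamma>) \<Rightarrow> (Jmat a i1 i3 \<gamma> *v \<omega>) \<bullet> \<gamma>) = C"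
  using assms
  by (simp add: sigma_u_def Jmat_def inertia_def outer_def rxg_def contact_def offset_def
      cross3_def inner_vec_def matrix_vector_mult_def sum_3)

definition state_basis :: "nat \<Rightarrow> (real^3) \<times> (real^3)" where
  "state_basis k = [(axis 1 1, 0), (axis 2 1, 0), (axis 3 1, 0),
                    (0, axis 1 1), (0, axis 2 1), (0, axis 3 1)] ! k"

definition state_matrix ::
  "((real^3) \<times> (real^3) \<Rightarrow> (real^3) \<times> (real^3)) \<Rightarrow> real Matrix.mat" where
  "state_matrix D = Matrix.mat 6 6 (\<lambda>(j, k). state_basis j \<bullet> D (state_basis k))"

text \<open>\<open>is_P4 F p P\<close>: the characteristic polynomial of the linearization of the six-dimensional
  system at \<open>p\<close> is \<open>\<lambda>\<^sup>2 P(\<lambda>)\<close>. This determines \<open>P\<close> uniquely.\<close>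

definition is_P4 ::
  "((real^3) \<times> (real^3) \<Rightarrow> (real^3) \<times> (real^3)) \<Rightarrow> (real^3) \<times> (real^3) \<Rightarrow> real poly \<Rightarrow> bool" where
  "is_P4 F p P \<longleftrightarrow>
     (\<exists>D. (F has_derivative D) (at p) \<and> char_poly (state_matrix D) = monom 1 2 * P)"

definition linearly_stable ::
  "((real^3) \<times> (real^3) \<Rightarrow> (real^3) \<times> (real^3)) \<Rightarrow> (real^3) \<times> (real^3) \<Rightarrow> bool" where
  "linearly_stable F p \<longleftrightarrow>
     (\<exists>P. is_P4 F p P \<and> (\<forall>z. poly (map_poly complex_of_real P) z = 0 \<longrightarrow> Re z < 0))"

definition linearly_unstable ::
  "((real^3) \<times> (real^3) \<Rightarrow> (real^3) \<times> (real^3)) \<Rightarrow> (real^3) \<times> (real^3) \<Rightarrow> bool" where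
  "linearly_unstable F p \<longleftrightarrow>
     (\<exists>P. is_P4 F p P \<and> (\<exists>z. poly (map_poly complex_of_real P) z = 0 \<and> Re z > 0))"

end

theory Submission
  imports Defs
begin

text \<open>
  Write \<open>\<Omega> = C / i3\<close>. At \<open>\<sigma>\<^sub>u\<close> the vector \<open>r \<times> \<gamma>\<close> and the right-hand side that \<open>J\<inverse>\<close> is applied to
  both vanish, so to first order \<open>J\<close> may be replaced by \<open>diag(i1, i1, i3)\<close>. The perturbations
  of the two vertical components are constant, which accounts for the factor \<open>\<lambda>\<^sup>2\<close>. In the complex
  variables \<open>\<xi> = \<omega>\<^sub>1 + i \<omega>\<^sub>2\<close> and \<open>\<zeta> = \<gamma>\<^sub>1 + i \<gamma>\<^sub>2\<close> the horizontal part reads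
  \<open>i1 \<xi>' = - \<mu> (\<xi> - \<Omega> \<zeta>) + i (i3 - i1) \<Omega> \<xi> - i a \<zeta>\<close> and \<open>\<zeta>' = i \<xi> - i \<Omega> \<zeta>\<close>,
  a planar complex system with characteristic polynomial, up to the sign of \<open>b\<close>,
  \<open>Q(\<lambda>) = \<lambda>\<^sup>2 + (m + i b) \<lambda> + c\<close>, where \<open>m = \<mu> / i1\<close>, \<open>b = (i3 - 2 i1) \<Omega> / i1\<close> and
  \<open>c = ((i3 - i1) \<Omega>\<^sup>2 - a) / i1\<close>. The real polynomial is the product of \<open>Q\<close> with its
  conjugate: \<open>P\<^sub>4(\<lambda>) = (\<lambda>\<^sup>2 + m \<lambda> + c)\<^sup>2 + (b \<lambda>)\<^sup>2\<close>.

  The decisive point is that the product \<open>c\<close> of the two roots of \<open>Q\<close> is real, so that the second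
  root is a real multiple, by \<open>c / |z|\<^sup>2\<close>, of the conjugate of the first root \<open>z\<close>. Since the sum of
  the real parts of the roots is \<open>- m < 0\<close>, both real parts are negative if \<open>c > 0\<close>
  (\<open>quadratic_root_Re_neg\<close>), exactly one is positive if \<open>c < 0\<close> (\<open>quadratic_root_Re_pos\<close>), and
  \<open>0\<close> is a root if \<open>c = 0\<close>. The sign of \<open>c\<close> is that of \<open>(i3 - i1) C\<^sup>2 - a i3\<^sup>2\<close>, which is negative
  for \<open>i3 \<le> i1\<close> and otherwise changes sign at \<open>|C| = C\<^sup>*\<close>.

  The reduction to \<open>Q\<close> is carried by \<open>rolling_field_has_derivative\<close>, which computes the
  linearization, and by \<open>char_poly_lin_field\<close>, which computes its characteristic polynomial.
\<close>

section \<open>Linearization at the upper vertical rotation\<close>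

text \<open>The matrix \<open>J\<close> is a rank-one perturbation of a diagonal matrix by the horizontal vector
  \<open>s = r \<times> \<gamma>\<close>, so the Sherman-Morrison formula inverts it: \<open>q\<close> is the scalar product of \<open>s\<close> with
  the solution, and moving \<open>q s\<close> to the other side leaves a diagonal system.\<close>


lemma matrix_inv_Jmat_apply:
  fixes g y :: "real^3" and a i1 i3 q :: real
  assumes "i1 > 0" "i3 > 0"
    and q_eq: "q = a * (g $ 2 * y $ 1 - g $ 1 * y $ 2) / (i1 + a\<^sup>2 * ((g $ 1)\<^sup>2 + (g $ 2)\<^sup>2))"
  shows "matrix_inv (Jmat a i1 i3 g) *v y =
    vector [(y $ 1 - a * g $ 2 * q) / i1, (y $ 2 + a * g $ 1 * q) / i1, y $ 3 / i3]"
    (is "_ = ?w")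
proof -
  define J where "J = Jmat a i1 i3 g"
  have "invertible J"
    unfolding J_def by (rule invertible_Jmat[OF assms(1,2)])
  then have J: "matrix_inv J ** J = Finite_Cartesian_Product.mat 1"
    unfolding matrix_inv_def invertible_def by (metis (mono_tags, lifting) someI_ex)
  have "i1 + a\<^sup>2 * ((g $ 1)\<^sup>2 + (g $ 2)\<^sup>2) > 0"
    using assms(1) by (intro add_pos_nonneg) auto
  then have q: "q * (i1 + a\<^sup>2 * ((g $ 1)\<^sup>2 + (g $ 2)\<^sup>2)) = a * (g $ 2 * y $ 1 - g $ 1 * y $ 2)"
    unfolding q_eq by simp
  have s: "rxg a g = vector [a * g $ 2, - a * g $ 1, 0]"
    by (simp add: rxg_def contact_def offset_def cross3_def Finite_Cartesian_Product.vec_eq_iff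
        forall_3 algebra_simps)
  \<comment> \<open>consistency of \<open>q\<close>: it is indeed the scalar product of \<open>s\<close> with the proposed solution\<close>
  have sw: "a * g $ 2 * ((y $ 1 - a * g $ 2 * q) / i1) - a * g $ 1 * ((y $ 2 + a * g $ 1 * q) / i1) = q"
  proof -
    have "i1 * q = a * g $ 2 * (y $ 1 - a * g $ 2 * q) - a * g $ 1 * (y $ 2 + a * g $ 1 * q)"
      using q by (simp add: algebra_simps power2_eq_square)
    then have "q = (a * g $ 2 * (y $ 1 - a * g $ 2 * q) - a * g $ 1 * (y $ 2 + a * g $ 1 * q)) / i1"
      using assms(1) by (simp add: nonzero_eq_divide_eq mult.commute)
    then show ?thesis
      unfolding times_divide_eq_right diff_divide_distrib[symmetric] by (rule sym)
  qed
  have row: "(J *v x) $ 1 = i1 * x $ 1 + a * g $ 2 * (a * g $ 2 * x $ 1 - a * g $ 1 * x $ 2)"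
    "(J *v x) $ 2 = i1 * x $ 2 - a * g $ 1 * (a * g $ 2 * x $ 1 - a * g $ 1 * x $ 2)"
    "(J *v x) $ 3 = i3 * x $ 3" for x
    by (simp_all add: J_def Jmat_def s inertia_def outer_def matrix_vector_mult_def sum_3 algebra_simps)
  have "J *v ?w = y"
    unfolding Finite_Cartesian_Product.vec_eq_iff forall_3 row vector_3 sw using assms(1,2) by simp
  then have "matrix_inv J *v y = (matrix_inv J ** J) *v ?w"
    by (simp add: matrix_vector_mul_assoc[symmetric])
  then show ?thesis
    unfolding J unfolding J_def by simp
qed

lemma has_derivative_vector_3:
  fixes f1 f2 f3 :: "'a :: real_normed_vector \<Rightarrow> real"
  assumes "(f1 has_derivative d1) F" "(f2 has_derivative d2) F" "(f3 has_derivative d3) F"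
  shows "((\<lambda>p. vector [f1 p, f2 p, f3 p] :: real^3) has_derivative
    (\<lambda>h. vector [d1 h, d2 h, d3 h])) F"
proof -
  have "(vector [x, y, z] :: real^3) = x *\<^sub>R axis 1 1 + y *\<^sub>R axis 2 1 + z *\<^sub>R axis 3 1" for x y z
    by (simp add: Finite_Cartesian_Product.vec_eq_iff forall_3 axis_def)
  then show ?thesis
    using assms by (auto intro!: derivative_eq_intros)
qed

text \<open>The linearization at \<open>\<sigma>\<^sub>u\<close>, with angular velocity \<open>\<Omega>\<close> about the vertical.\<close>

definition lin_field :: "real \<Rightarrow> real \<Rightarrow> real \<Rightarrow> real \<Rightarrow> real \<Rightarrow>
    (real^3) \<times> (real^3) \<Rightarrow> (real^3) \<times> (real^3)" where
  "lin_field a i1 i3 \<mu> \<Omega> = (\<lambda>(x, u).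
     (vector [(- \<mu> * (x $ 1 - \<Omega> * u $ 1) - (i3 - i1) * \<Omega> * x $ 2 + a * u $ 2) / i1,
              (- \<mu> * (x $ 2 - \<Omega> * u $ 2) + (i3 - i1) * \<Omega> * x $ 1 - a * u $ 1) / i1,
              0],
      vector [\<Omega> * u $ 2 - x $ 2, x $ 1 - \<Omega> * u $ 1, 0]))"

text \<open>Writing the field as \<open>J\<inverse> y\<close>, the correction term of the inverse is a product of \<open>r \<times> \<gamma>\<close> with
  the scalar \<open>q\<close>, and both vanish at \<open>\<sigma>\<^sub>u\<close>, so it contributes nothing to the derivative. In the same
  way \<open>\<omega> \<bullet> (r \<times> \<gamma>)'\<close> has no first-order part there, because \<open>a \<times> (\<gamma> \<times> \<omega>)\<close> vanishes there and
  is always horizontal, while \<open>\<omega>\<close> is vertical at \<open>\<sigma>\<^sub>u\<close>.\<close>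

lemma rolling_field_has_derivative:
  assumes "i1 > 0" "i3 > 0"
  shows "(rolling_field a i1 i3 \<mu> has_derivative lin_field a i1 i3 \<mu> (C / i3)) (at (sigma_u i3 C))"
proof -
  define W where "W = C / i3"
  define p0 where "p0 = sigma_u i3 C"
  define y where "y = (\<lambda>p. case p of (w, g) \<Rightarrow>
        (- \<mu> *\<^sub>R (g \<times> (w \<times> g)) - w \<times> (inertia i1 i3 *v w)
          - (w \<bullet> rxg_dot a w g - 1) *\<^sub>R rxg a g))"
  define q where "q = (\<lambda>p. a * (snd p $ 2 * y p $ 1 - snd p $ 1 * y p $ 2) /
      (i1 + a\<^sup>2 * ((snd p $ 1)\<^sup>2 + (snd p $ 2)\<^sup>2)))"
  have field: "rolling_field a i1 i3 \<mu> = (\<lambda>p.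
     (vector [(y p $ 1 - a * snd p $ 2 * q p) / i1, (y p $ 2 + a * snd p $ 1 * q p) / i1, y p $ 3 / i3],
      vector [fst p $ 3 * snd p $ 2 - fst p $ 2 * snd p $ 3,
              fst p $ 1 * snd p $ 3 - fst p $ 3 * snd p $ 1,
              fst p $ 2 * snd p $ 1 - fst p $ 1 * snd p $ 2]))" (is "_ = ?f")
  proof
    fix p
    have "rolling_field a i1 i3 \<mu> p =
        (matrix_inv (Jmat a i1 i3 (snd p)) *v y p, - (fst p \<times> snd p))"
      by (simp add: rolling_field_def y_def split_beta)
    also have "- (fst p \<times> snd p) =
        vector [fst p $ 3 * snd p $ 2 - fst p $ 2 * snd p $ 3,
                fst p $ 1 * snd p $ 3 - fst p $ 3 * snd p $ 1,
                fst p $ 2 * snd p $ 1 - fst p $ 1 * snd p $ 2]"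
      by (simp add: cross3_def Finite_Cartesian_Product.vec_eq_iff forall_3)
    finally show "rolling_field a i1 i3 \<mu> p = ?f p"
      unfolding matrix_inv_Jmat_apply[OF assms fun_cong[OF q_def]] .
  qed
  have y1: "(\<lambda>p. y p $ 1) = (\<lambda>p.
       - \<mu> * (fst p $ 1 * ((snd p $ 2)\<^sup>2 + (snd p $ 3)\<^sup>2)
         - snd p $ 1 * (fst p $ 2 * snd p $ 2 + fst p $ 3 * snd p $ 3))
       - (i3 - i1) * fst p $ 2 * fst p $ 3
       - (fst p \<bullet> rxg_dot a (fst p) (snd p) - 1) * (a * snd p $ 2))"
    and y2: "(\<lambda>p. y p $ 2) = (\<lambda>p.
       - \<mu> * (fst p $ 2 * ((snd p $ 1)\<^sup>2 + (snd p $ 3)\<^sup>2)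
         - snd p $ 2 * (fst p $ 1 * snd p $ 1 + fst p $ 3 * snd p $ 3))
       + (i3 - i1) * fst p $ 1 * fst p $ 3
       + (fst p \<bullet> rxg_dot a (fst p) (snd p) - 1) * (a * snd p $ 1))"
    and y3: "(\<lambda>p. y p $ 3) = (\<lambda>p.
       - \<mu> * (fst p $ 3 * ((snd p $ 1)\<^sup>2 + (snd p $ 2)\<^sup>2)
         - snd p $ 3 * (fst p $ 1 * snd p $ 1 + fst p $ 2 * snd p $ 2)))"
    and e: "(\<lambda>p. fst p \<bullet> rxg_dot a (fst p) (snd p)) = (\<lambda>p.
       a * (fst p $ 1 * (snd p $ 3 * fst p $ 1 - snd p $ 1 * fst p $ 3)
         - fst p $ 2 * (snd p $ 2 * fst p $ 3 - snd p $ 3 * fst p $ 2)))"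
    by (simp_all add: fun_eq_iff y_def split_beta rxg_def rxg_dot_def contact_def offset_def
        cross3_def inertia_def matrix_vector_mult_def sum_3 inner_vec_def algebra_simps power2_eq_square)
  have p0: "fst p0 $ 1 = 0" "fst p0 $ 2 = 0" "fst p0 $ 3 = W"
    "snd p0 $ 1 = 0" "snd p0 $ 2 = 0" "snd p0 $ 3 = 1"
    by (simp_all add: p0_def sigma_u_def W_def)
  have fst_d: "((\<lambda>p. fst p $ k) has_derivative (\<lambda>h. fst h $ k)) (at p0)"
    and snd_d: "((\<lambda>p. snd p $ k) has_derivative (\<lambda>h. snd h $ k)) (at p0)" for k
    by (auto intro!: derivative_eq_intros bounded_linear.has_derivative[OF bounded_linear_vec_nth])
  have e_d: "((\<lambda>p. fst p \<bullet> rxg_dot a (fst p) (snd p)) has_derivative (\<lambda>h. 0)) (at p0)"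
    unfolding e by (rule derivative_eq_intros fst_d snd_d refl)+ (simp add: p0 fun_eq_iff)
  have y1_d: "((\<lambda>p. y p $ 1) has_derivative
      (\<lambda>h. - \<mu> * (fst h $ 1 - W * snd h $ 1) - (i3 - i1) * W * fst h $ 2 + a * snd h $ 2)) (at p0)"
    unfolding y1 by (rule derivative_eq_intros fst_d snd_d e_d refl)+
      (simp add: p0 fun_eq_iff fun_cong[OF e] algebra_simps)
  have y2_d: "((\<lambda>p. y p $ 2) has_derivative
      (\<lambda>h. - \<mu> * (fst h $ 2 - W * snd h $ 2) + (i3 - i1) * W * fst h $ 1 - a * snd h $ 1)) (at p0)"
    unfolding y2 by (rule derivative_eq_intros fst_d snd_d e_d refl)+
      (simp add: p0 fun_eq_iff fun_cong[OF e] algebra_simps)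
  have y3_d: "((\<lambda>p. y p $ 3) has_derivative (\<lambda>h. 0)) (at p0)"
    unfolding y3 by (rule derivative_eq_intros fst_d snd_d refl)+ (simp add: p0 fun_eq_iff)
  have y0: "y p0 $ 1 = 0" "y p0 $ 2 = 0"
    by (simp_all add: fun_cong[OF y1] fun_cong[OF y2] p0)
  have q_d: "(q has_derivative (\<lambda>h. 0)) (at p0)"
    unfolding q_def using assms
    by - (rule derivative_eq_intros fst_d snd_d y1_d y2_d refl | simp add: p0 y0; fail)+
  have q0: "q p0 = 0"
    by (simp add: q_def p0)
  have nz: "i1 \<noteq> 0" "i3 \<noteq> 0"
    using assms by auto
  show ?thesis
    unfolding field lin_field_def p0_def[symmetric] W_def[symmetric] split_beta
    by (intro has_derivative_Pair has_derivative_vector_3;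
        (rule derivative_eq_intros fst_d snd_d y1_d y2_d y3_d q_d refl nz)+,
        simp add: p0 q0 nz fun_eq_iff field_simps)
qed

section \<open>The characteristic polynomial\<close>

lemma det_mat_of_rows_list_Cons:
  fixes r :: "'a :: comm_ring_1 list"
  assumes "length rs = n" "\<forall>x\<in>set rs. length x = Suc n"
  shows "Determinant.det (mat_of_rows_list (Suc n) (r # rs)) =
    (\<Sum>j<Suc n. r ! j * ((-1) ^ j *
       Determinant.det (mat_of_rows_list n (map (\<lambda>x. take j x @ drop (Suc j) x) rs))))"
proof -
  let ?A = "mat_of_rows_list (Suc n) (r # rs)"
  have "mat_delete ?A 0 j = mat_of_rows_list n (map (\<lambda>x. take j x @ drop (Suc j) x) rs)"
    if "j < Suc n" for j
    using that assms
    by (intro eq_matI) (auto simp: mat_delete_def mat_of_rows_list_def nth_append min_def)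
  then show ?thesis
    using assms(1)
    by (subst laplace_expansion_row[of ?A "Suc n" 0])
      (auto simp: cofactor_def mat_of_rows_list_def mult.assoc intro!: sum.cong)
qed

text \<open>Two congruence rules for the simplifier that let it expand a sparse determinant recursively:
  \<open>mult_cong_nonzero\<close> never enters a minor that belongs to a zero entry, and \<open>sum_index_cong\<close> keeps it
  from expanding minors before the summation index is a number.\<close>

lemma mult_cong_nonzero:
  fixes x y :: "'a :: mult_zero"
  assumes "x = x'" "x' \<noteq> 0 \<Longrightarrow> y = y'"
  shows "x * y = x' * y'"
  using assms by (cases "x' = 0") auto

lemma sum_index_cong:
  "A = B \<Longrightarrow> sum f A = sum f B"
  by simp

text \<open>The rows and columns of the two vertical components split off two factors \<open>l\<close>. The remaining four by four
  matrix commutes with the simultaneous rotation of both horizontal planes, so its determinant is the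
  squared modulus of a complex determinant of size two, with real part \<open>l p + q w - s\<close> and imaginary
  part, up to sign, \<open>r + q l - p w\<close>.\<close>

lemma det_linearization:
  fixes p q r s w l :: "'a :: comm_ring_1"
  shows "Determinant.det (mat_of_rows_list 6
    [[p, q, 0, - r, - s, 0],
     [- q, p, 0, s, - r, 0],
     [0, 0, l, 0, 0, 0],
     [0, 1, 0, l, - w, 0],
     [- 1, 0, 0, w, l, 0],
     [0, 0, 0, 0, 0, l]]) = l\<^sup>2 * ((l * p + q * w - s)\<^sup>2 + (r + q * l - p * w)\<^sup>2)"
proof -
  have num: "6 = Suc (Suc (Suc (Suc (Suc (Suc 0)))))" by simp
  have "Determinant.det (mat_of_rows_list 0 []) = (1 :: 'a)"
    by (simp add: mat_of_rows_list_def)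
  then show ?thesis
    unfolding num
    by (simp add: det_mat_of_rows_list_Cons cong: mult_cong_nonzero sum_index_cong)
      (simp add: algebra_simps power2_eq_square)
qed
lemma state_matrix_lin_field:
  "state_matrix (lin_field a i1 i3 \<mu> \<Omega>) = mat_of_rows_list 6
    [[- \<mu> / i1, - ((i3 - i1) * \<Omega> / i1), 0, \<mu> * \<Omega> / i1, a / i1, 0],
     [(i3 - i1) * \<Omega> / i1, - \<mu> / i1, 0, - a / i1, \<mu> * \<Omega> / i1, 0],
     [0, 0, 0, 0, 0, 0],
     [0, - 1, 0, 0, \<Omega>, 0],
     [1, 0, 0, - \<Omega>, 0, 0],
     [0, 0, 0, 0, 0, 0]]"
    (is "_ = mat_of_rows_list 6 ?rows")
proof -
  have idx: "j < 6 \<longleftrightarrow> j = 0 \<or> j = 1 \<or> j = 2 \<or> j = 3 \<or> j = 4 \<or> j = 5" for j :: nat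
    by auto
  have axes: "(axis 1 1 :: real^3) = vector [1, 0, 0]" "(axis 2 1 :: real^3) = vector [0, 1, 0]"
    "(axis 3 1 :: real^3) = vector [0, 0, 1]"
    by (simp_all add: Finite_Cartesian_Product.vec_eq_iff forall_3 axis_def)
  have entries: "state_basis j \<bullet> lin_field a i1 i3 \<mu> \<Omega> (state_basis k) = ?rows ! j ! k"
    if "j < 6" "k < 6" for j k
    using that unfolding idx
    by (elim disjE; simp add: state_basis_def lin_field_def inner_prod_def inner_vec_def sum_3 axes)
  show ?thesis
    unfolding state_matrix_def mat_of_rows_list_def
    by (rule cong_mat) (simp, rule refl, simp only: split_conv entries)
qed

lemma char_poly_lin_field:
  fixes a i1 i3 \<mu> \<Omega> :: real
  assumes "i1 \<noteq> 0"
  defines "c \<equiv> ((i3 - i1) * \<Omega>\<^sup>2 - a) / i1" and "b \<equiv> (i3 - 2 * i1) * \<Omega> / i1"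
  shows "char_poly (state_matrix (lin_field a i1 i3 \<mu> \<Omega>)) =
    monom 1 2 * ([:c, \<mu> / i1, 1:]\<^sup>2 + [:0, b:]\<^sup>2)"
proof -
  define p q r s w l where "p = [:\<mu> / i1, 1:]" and "q = [:(i3 - i1) * \<Omega> / i1:]"
    and "r = [:\<mu> * \<Omega> / i1:]" and "s = [:a / i1:]" and "w = [:\<Omega>:]" and "l = [:0, 1 :: real:]"
  note defs = p_def q_def r_def s_def w_def l_def
  have idx: "j < 6 \<longleftrightarrow> j = 0 \<or> j = 1 \<or> j = 2 \<or> j = 3 \<or> j = 4 \<or> j = 5" for j :: nat
    by auto
  have "char_poly_matrix (state_matrix (lin_field a i1 i3 \<mu> \<Omega>)) = mat_of_rows_list 6
    [[p, q, 0, - r, - s, 0],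
     [- q, p, 0, s, - r, 0],
     [0, 0, l, 0, 0, 0],
     [0, 1, 0, l, - w, 0],
     [- 1, 0, 0, w, l, 0],
     [0, 0, 0, 0, 0, l]]"
    (is "char_poly_matrix ?M = ?B")
  proof (rule eq_matI)
    fix j k
    assume "j < dim_row ?B" "k < dim_col ?B"
    then have jk: "j < 6" "k < 6"
      by (simp_all add: mat_of_rows_list_def)
    then have "char_poly_matrix ?M $$ (j, k) = (if j = k then [:0, 1:] else 0) + [:- ?M $$ (j, k):]"
      by (simp add: char_poly_matrix_def state_matrix_def)
    also have "\<dots> = ?B $$ (j, k)"
      using jk unfolding state_matrix_lin_field idx
      by (elim disjE; simp add: mat_of_rows_list_def one_pCons defs)
    finally show "char_poly_matrix ?M $$ (j, k) = ?B $$ (j, k)" .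
  qed (simp_all add: char_poly_matrix_def mat_of_rows_list_def state_matrix_def)
  then have "char_poly (state_matrix (lin_field a i1 i3 \<mu> \<Omega>)) =
      l\<^sup>2 * ((l * p + q * w - s)\<^sup>2 + (r + q * l - p * w)\<^sup>2)"
    unfolding char_poly_def det_linearization[symmetric] by simp
  also have "l\<^sup>2 = monom 1 2"
    by (simp add: l_def monom_altdef)
  also have "l * p + q * w - s = [:c, \<mu> / i1, 1:]"
    by (simp add: defs c_def diff_divide_distrib power2_eq_square mult.assoc)
  also have "r + q * l - p * w = [:0, b:]"
    using assms(1) by (simp add: defs b_def field_simps)
  finally show ?thesis .
qed

text \<open>Both the derivative and the cofactor of \<open>\<lambda>\<^sup>2\<close> are unique, so one computed factorization decides
  every statement about \<open>P\<^sub>4\<close>, including the failure of linear stability.\<close>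

lemma is_P4_unique_iff:
  assumes "(F has_derivative D) (at p)" "char_poly (state_matrix D) = monom 1 2 * P\<^sub>0"
  shows "is_P4 F p P \<longleftrightarrow> P = P\<^sub>0"
proof -
  have "(monom 1 2 :: real poly) \<noteq> 0"
    by simp
  then show ?thesis
    unfolding is_P4_def using assms has_derivative_unique[OF _ assms(1)]
    by (metis mult_left_cancel)
qed

section \<open>Location of the roots\<close>

lemma poly_sum_squares_factor:
  fixes b c m :: real and z :: complex
  shows "poly (map_poly complex_of_real ([:c, m, 1:]\<^sup>2 + [:0, b:]\<^sup>2)) z =
    (z * (z + Complex m b) + c) * (z * (z + Complex m (- b)) + c)"
proof -
  have *: "[:c, m, 1:]\<^sup>2 + [:0, b:]\<^sup>2 = [:c\<^sup>2, 2 * m * c, m\<^sup>2 + 2 * c + b\<^sup>2, 2 * m, 1:]"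
    by (simp add: power2_eq_square algebra_simps)
  have "poly (map_poly complex_of_real ([:c, m, 1:]\<^sup>2 + [:0, b:]\<^sup>2)) z =
    (z\<^sup>2 + m * z + c)\<^sup>2 + (b * z)\<^sup>2"
    unfolding * by (simp add: map_poly_pCons power2_eq_square algebra_simps)
  also have "\<dots> = (z * (z + (m + \<i> * b)) + c) * (z * (z + (m - \<i> * b)) + c)"
    by (simp add: power2_eq_square algebra_simps)
  finally show ?thesis
    by (simp add: Complex_eq)
qed

text \<open>Dividing the equation by \<open>z\<close> and taking real parts gives \<open>Re z (1 + c / |z|\<^sup>2) = - m\<close>; the
  imaginary coefficient \<open>b\<close> drops out because \<open>c\<close> is real.\<close>

lemma quadratic_root_Re_neg:
  assumes "z * (z + Complex m b) + complex_of_real c = 0" "c > 0" "m > 0"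
  shows "Re z < 0"
proof -
  have nz: "z \<noteq> 0"
    using assms by auto
  then have "z + Complex m b = - (c / z)"
    using assms(1) by (simp add: eq_neg_iff_add_eq_0 field_simps)
  then have "Re (z + Complex m b) = Re (- (c / z))"
    by simp
  then have "Re z * (1 + c / (cmod z)\<^sup>2) = - m"
    by (simp add: Re_divide cmod_power2 algebra_simps)
  moreover have "1 + c / (cmod z)\<^sup>2 > 0"
    using assms(2) by (intro add_pos_nonneg) auto
  ultimately show ?thesis
    using assms(3) by (metis mult_nonneg_nonneg neg_0_le_iff_le not_le less_imp_le)
qed

text \<open>Since the product \<open>c\<close> of the two roots is real and negative, each is a negative multiple of the
  conjugate of the other, so their real parts have opposite signs or both vanish; the latter is
  excluded because these add up to \<open>- m\<close>.\<close>

lemma quadratic_root_Re_pos: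
  assumes "c < 0" "m > 0"
  obtains z where "z * (z + Complex m b) + complex_of_real c = 0" "Re z > 0"
proof -
  define w where "w = Complex m b"
  define d where "d = csqrt (w\<^sup>2 - 4 * c)"
  define z1 z2 where "z1 = (d - w) / 2" and "z2 = (- d - w) / 2"
  have d2: "d\<^sup>2 = w\<^sup>2 - 4 * c"
    by (simp add: d_def)
  have root: "z1 * (z1 + w) + c = 0" "z2 * (z2 + w) + c = 0"
    using d2 by (simp_all add: z1_def z2_def field_simps power2_eq_square)
  have sum: "Re z1 + Re z2 = - m"
    by (simp add: z1_def z2_def w_def add_divide_distrib[symmetric])
  have prod: "z1 * z2 = c"
    using d2 by (simp add: z1_def z2_def field_simps power2_eq_square)
  then have nz: "z1 \<noteq> 0"
    using assms by auto
  then have "z2 = c / z1"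
    using prod by (simp add: field_simps)
  then have "Re z2 = c / (cmod z1)\<^sup>2 * Re z1"
    by (simp add: Re_divide cmod_power2)
  moreover have "c / (cmod z1)\<^sup>2 < 0"
    using assms nz by (simp add: divide_neg_pos)
  ultimately obtain k where "Re z2 = k * Re z1" "k < 0"
    by blast
  then have "Re z1 > 0 \<or> Re z2 > 0"
    using sum assms(2) by (cases "Re z1" "0 :: real" rule: linorder_cases) (auto simp: mult_neg_neg)
  then show thesis
    using root that by (auto simp: w_def)
qed

theorem mainTheorem4:
  fixes a i1 i3 \<mu>\<^sub>r C :: real
  assumes "a > 0" and "i1 > 0" and "i3 > 0" and "\<mu>\<^sub>r > 0"
  shows "(i3 \<le> i1 \<longrightarrow> linearly_unstable (rolling_field a i1 i3 \<mu>\<^sub>r) (sigma_u i3 C)) \<and>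
         (i3 > i1 \<longrightarrow>
           (linearly_stable (rolling_field a i1 i3 \<mu>\<^sub>r) (sigma_u i3 C) \<longleftrightarrow>
             \<bar>C\<bar> > i3 * sqrt a / sqrt \<bar>i1 - i3\<bar>))"
proof -
  define \<Omega> where "\<Omega> = C / i3"
  define b c m where "b = (i3 - 2 * i1) * \<Omega> / i1" and "c = ((i3 - i1) * \<Omega>\<^sup>2 - a) / i1"
    and "m = \<mu>\<^sub>r / i1"
  have "m > 0"
    using assms by (simp add: m_def)
  have P4: "is_P4 (rolling_field a i1 i3 \<mu>\<^sub>r) (sigma_u i3 C) P \<longleftrightarrow> P = [:c, m, 1:]\<^sup>2 + [:0, b:]\<^sup>2" for P
    using assms unfolding b_def c_def m_def \<Omega>_def
    by (intro is_P4_unique_iff[OF rolling_field_has_derivative] char_poly_lin_field) auto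
  have stable: "linearly_stable (rolling_field a i1 i3 \<mu>\<^sub>r) (sigma_u i3 C) \<longleftrightarrow> c > 0"
  proof
    assume "c > 0"
    then show "linearly_stable (rolling_field a i1 i3 \<mu>\<^sub>r) (sigma_u i3 C)"
      unfolding linearly_stable_def P4 using quadratic_root_Re_neg[OF _ _ \<open>m > 0\<close>]
      by (auto simp: poly_sum_squares_factor)
  next
    assume "linearly_stable (rolling_field a i1 i3 \<mu>\<^sub>r) (sigma_u i3 C)"
    then have neg: "Re z < 0" if "z * (z + Complex m b) + complex_of_real c = 0" for z
      unfolding linearly_stable_def P4 using that by (auto simp: poly_sum_squares_factor)
    have "c \<noteq> 0"
      using neg[of 0] by auto
    moreover have "\<not> c < 0"
      using neg quadratic_root_Re_pos[OF _ \<open>m > 0\<close>] by (metis less_asym)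
    ultimately show "c > 0"
      by linarith
  qed
  have unstable: "linearly_unstable (rolling_field a i1 i3 \<mu>\<^sub>r) (sigma_u i3 C)" if "c < 0"
    using quadratic_root_Re_pos[OF that \<open>m > 0\<close>, of b]
    unfolding linearly_unstable_def P4 by (metis mult_zero_left poly_sum_squares_factor)
  have "c < 0" if "i3 \<le> i1"
  proof -
    have "(i3 - i1) * \<Omega>\<^sup>2 \<le> 0"
      using that by (intro mult_nonpos_nonneg) auto
    then show ?thesis
      using assms by (simp add: c_def divide_neg_pos)
  qed
  moreover have "c > 0 \<longleftrightarrow> \<bar>C\<bar> > i3 * sqrt a / sqrt \<bar>i1 - i3\<bar>" if "i3 > i1"
  proof -
    have "c > 0 \<longleftrightarrow> a < (i3 - i1) * \<Omega>\<^sup>2"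
      using assms by (simp add: c_def zero_less_divide_iff)
    also have "\<dots> \<longleftrightarrow> a / (i3 - i1) < \<Omega>\<^sup>2"
      using that by (simp add: field_simps)
    also have "\<dots> \<longleftrightarrow> sqrt (a / (i3 - i1)) < \<bar>\<Omega>\<bar>"
      by (metis real_sqrt_abs real_sqrt_less_iff)
    also have "\<dots> \<longleftrightarrow> i3 * sqrt a / sqrt \<bar>i1 - i3\<bar> < \<bar>C\<bar>"
      using assms that by (simp add: \<Omega>_def real_sqrt_divide abs_divide field_simps)
    finally show ?thesis .
  qed
  ultimately show ?thesis
    using stable unstable by blast
qed

end
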